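(* Let $G = A \rtimes \langle t \rangle$ be a finitely generated group, where $A$ is abelian and $\langle t \rangle \cong C_\infty$. Then $A$ has density $\delta_S(A) = 0$ in $G$, with respect to any finite generating set $S$ of $G$ that takes the form $S = S_0 \cup \{t\}$ with $S_0 \subseteq A$.
   Context: For a group $G$ with finite generating set $S$, $l_S(g)$ denotes the distance between $1$ and $g$ in the Cayley graph of $G$ with respect to $S$ (the word length of $g$ over $S \cup S^{-1}$), and $B_S(n) = \{ g \in G \mid l_S(g) \le n\}$ for $n \in \mathbb{N}_0$. The density of a subset $X \subseteq G$ with respect to $S$ is $$\delta_S(X) = \limsup_{n \to \infty} \frac{|X \cap B_S(n)|}{|B_S(n)|}.$$ *)

theory Defs
  imports "HOL-Algebra.Elementary_Groups" "HOL-Library.Extended_Real"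
begin

definition finite_generating_set :: "('a, 'b) monoid_scheme \<Rightarrow> 'a set \<Rightarrow> bool" where
  "finite_generating_set G S \<longleftrightarrow> finite S \<and> S \<subseteq> carrier G \<and> generate G S = carrier G"

definition internal_semidirect_product ::
    "('a, 'b) monoid_scheme \<Rightarrow> 'a set \<Rightarrow> 'a set \<Rightarrow> bool" where
  "internal_semidirect_product G N H \<longleftrightarrow>
     N \<lhd> G \<and> subgroup H G \<and> N \<inter> H = {\<one>\<^bsub>G\<^esub>} \<and> N <#>\<^bsub>G\<^esub> H = carrier G"

definition words_for :: "('a, 'b) monoid_scheme \<Rightarrow> 'a set \<Rightarrow> 'a \<Rightarrow> 'a list set" where
  "words_for G S g =
     {ws. set ws \<subseteq> S \<union> m_inv G ` S \<and> foldr (\<otimes>\<^bsub>G\<^esub>) ws \<one>\<^bsub>G\<^esub> = g}"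

text \<open>
  The word length is the distance from the identity to \<open>g\<close> in the Cayley graph. It takes values
  in \<open>enat\<close> so that it is \<open>\<infinity>\<close> for elements outside the subgroup generated by \<open>S\<close>.
\<close>

definition word_length :: "('a, 'b) monoid_scheme \<Rightarrow> 'a set \<Rightarrow> 'a \<Rightarrow> enat" where
  "word_length G S g = (INF ws \<in> words_for G S g. enat (length ws))"

definition word_ball :: "('a, 'b) monoid_scheme \<Rightarrow> 'a set \<Rightarrow> nat \<Rightarrow> 'a set" where
  "word_ball G S n = {g \<in> carrier G. word_length G S g \<le> enat n}"

definition group_density :: "('a, 'b) monoid_scheme \<Rightarrow> 'a set \<Rightarrow> 'a set \<Rightarrow> ereal" where
  "group_density G S X =
     limsup (\<lambda>n. ereal (real (card (X \<inter> word_ball G S n)) / real (card (word_ball G S n))))"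

end

theory Submission
  imports Defs "HOL-Algebra.Multiplicative_Group"
begin

text \<open>
  An element of \<open>A\<close> is a lamp configuration: a product of conjugates \<open>t\<^sup>i s t\<^sup>-\<^sup>i\<close>, collected by a cursor
  that moves along the integers. Let \<open>B\<^sub>n\<close> be the ball of radius \<open>n\<close>, and fix \<open>M\<close>. If a word of length at
  most \<open>n\<close> for \<open>a \<in> A\<close> lets the cursor travel to distance at least \<open>M\<close> on some side of the origin, then the
  same lamps can be collected at no greater cost by a tour that ends at any of \<open>M + 1\<close> positions
  instead of the origin, so that \<open>M + 1\<close> elements \<open>a t\<^sup>k\<close> lie in \<open>B\<^sub>n\<close>. All other \<open>a \<in> A \<inter> B\<^sub>n\<close> lie in a
  box of side \<open>n\<close> spanned by a fixed finite family of commuting conjugates. Such boxes are doubling, and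
  arbitrarily many translates by powers of \<open>t\<close> of a proportionally smaller box fit into \<open>B\<^sub>n\<close> once \<open>n\<close>
  is large. Hence \<open>(M + 1) \<bar>A \<inter> B\<^sub>n\<bar> \<le> 3 \<bar>B\<^sub>n\<bar>\<close> for large \<open>n\<close>.
\<close>

section \<open>Balls for the word metric\<close>

text \<open>An infimum lies strictly below a bound exactly when some member does, so the bound
  \<open>n\<close> on the length is first replaced by the strict bound \<open>Suc n\<close>.\<close>

lemma mem_word_ball_iff:
  "g \<in> word_ball G S n \<longleftrightarrow> g \<in> carrier G \<and> (\<exists>ws \<in> words_for G S g. length ws \<le> n)"
proof -
  have "word_length G S g \<le> enat n \<longleftrightarrow> word_length G S g < enat (Suc n)"
    by (cases "word_length G S g") auto
  then show ?thesis
    by (auto simp: word_ball_def word_length_def INF_less_iff less_Suc_eq_le)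
qed

lemma word_ball_mono: "m \<le> n \<Longrightarrow> word_ball G S m \<subseteq> word_ball G S n"
  unfolding mem_word_ball_iff subset_iff by (meson le_trans)

lemma finite_word_ball:
  assumes "finite S"
  shows "finite (word_ball G S n)"
proof -
  let ?W = "{ws. set ws \<subseteq> S \<union> m_inv G ` S \<and> length ws \<le> n}"
  have "word_ball G S n \<subseteq> (\<lambda>ws. foldr (\<otimes>\<^bsub>G\<^esub>) ws \<one>\<^bsub>G\<^esub>) ` ?W"
    by (auto simp: mem_word_ball_iff words_for_def)
  moreover have "finite ?W"
    using assms by (intro finite_lists_length_le) auto
  ultimately show ?thesis
    by (rule finite_surj[rotated])
qed

context group
begin

lemma foldr_mult_closed: "set ws \<subseteq> carrier G \<Longrightarrow> foldr (\<otimes>) ws \<one> \<in> carrier G"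
  by (induction ws) auto

lemma foldr_mult_append:
  "set us \<subseteq> carrier G \<Longrightarrow> set ws \<subseteq> carrier G \<Longrightarrow>
    foldr (\<otimes>) (us @ ws) \<one> = foldr (\<otimes>) us \<one> \<otimes> foldr (\<otimes>) ws \<one>"
  by (induction us) (auto simp: m_assoc foldr_mult_closed simp del: foldr_append)

lemma mem_word_ballI:
  "set ws \<subseteq> S \<union> m_inv G ` S \<Longrightarrow> S \<subseteq> carrier G \<Longrightarrow> length ws \<le> n \<Longrightarrow>
    foldr (\<otimes>) ws \<one> \<in> word_ball G S n"
  by (auto simp: mem_word_ball_iff words_for_def intro!: foldr_mult_closed)

lemma word_ball_mult:
  assumes "S \<subseteq> carrier G" "g \<in> word_ball G S m" "h \<in> word_ball G S n"
  shows "g \<otimes> h \<in> word_ball G S (m + n)"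
proof -
  from assms obtain us ws where
    us: "set us \<subseteq> S \<union> m_inv G ` S" "foldr (\<otimes>) us \<one> = g" "length us \<le> m" and
    ws: "set ws \<subseteq> S \<union> m_inv G ` S" "foldr (\<otimes>) ws \<one> = h" "length ws \<le> n"
    by (auto simp: mem_word_ball_iff words_for_def)
  have "set us \<subseteq> carrier G" "set ws \<subseteq> carrier G"
    using us(1) ws(1) assms(1) by auto
  then have "foldr (\<otimes>) (us @ ws) \<one> = g \<otimes> h"
    using us ws by (simp add: foldr_mult_append del: foldr_append)
  then show ?thesis
    using mem_word_ballI[of "us @ ws" S "m + n"] us ws assms(1) by auto
qed

lemma one_in_word_ball: "\<one> \<in> word_ball G S n"
  by (auto simp: mem_word_ball_iff words_for_def intro!: exI[of _ "[]"])

lemma word_ball_inv: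
  assumes "S \<subseteq> carrier G" "g \<in> word_ball G S n"
  shows "inv g \<in> word_ball G S n"
proof -
  have inv_foldr: "inv (foldr (\<otimes>) ws \<one>) \<in> word_ball G S (length ws)"
    if "set ws \<subseteq> S \<union> m_inv G ` S" for ws
    using that
  proof (induction ws)
    case Nil
    show ?case by (simp add: one_in_word_ball)
  next
    case (Cons y ws)
    have "S \<union> m_inv G ` S \<subseteq> carrier G"
      using assms(1) by auto
    with Cons.prems have "set (y # ws) \<subseteq> carrier G"
      by (rule order_trans)
    then have closed: "y \<in> carrier G" "set ws \<subseteq> carrier G"
      by simp_all
    have "inv y \<in> S \<union> m_inv G ` S"
      using Cons.prems assms(1) by (auto simp: subset_iff)
    then have "inv y \<in> word_ball G S 1"
      using mem_word_ballI[of "[inv y]" S 1] closed assms(1) by simp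
    with Cons have "inv (foldr (\<otimes>) ws \<one>) \<otimes> inv y \<in> word_ball G S (length ws + 1)"
      by (intro word_ball_mult[OF assms(1)]) simp_all
    then show ?case
      using closed by (simp add: inv_mult_group foldr_mult_closed)
  qed
  from assms(2) obtain ws where
    ws: "set ws \<subseteq> S \<union> m_inv G ` S" "foldr (\<otimes>) ws \<one> = g" "length ws \<le> n"
    by (auto simp: mem_word_ball_iff words_for_def)
  show ?thesis
    using subsetD[OF word_ball_mono[OF ws(3)] inv_foldr[OF ws(1)]] by (simp only: ws(2))
qed

lemma int_pow_in_word_ball:
  assumes "S \<subseteq> carrier G" "s \<in> S"
  shows "s [^] (k :: int) \<in> word_ball G S (nat \<bar>k\<bar>)"
proof -
  have s: "s \<in> carrier G" "s \<in> word_ball G S 1" "inv s \<in> word_ball G S 1"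
    using assms mem_word_ballI[of "[s]" S 1] mem_word_ballI[of "[inv s]" S 1] by auto
  have "s [^] int n \<in> word_ball G S n \<and> s [^] (- int n) \<in> word_ball G S n" for n
  proof (induction n)
    case 0
    show ?case by (simp add: one_in_word_ball)
  next
    case (Suc n)
    have "s [^] int (Suc n) = s [^] int n \<otimes> s"
      "s [^] (- int (Suc n)) = s [^] (- int n) \<otimes> inv s"
      using s(1) int_pow_mult[of s "int n" 1] int_pow_mult[of s "- int n" "-1"]
      by (simp_all add: int_pow_neg add.commute)
    then show ?case
      using Suc word_ball_mult[OF assms(1)] s(2,3) by (metis Suc_eq_plus1)
  qed
  from this[of "nat \<bar>k\<bar>"] show ?thesis
    by (cases "k \<ge> 0") auto
qed

lemma card_mult_le_if_translates:
  assumes "X \<subseteq> carrier G" "finite B" "finite K"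
    and "\<And>x k. x \<in> X \<Longrightarrow> k \<in> K \<Longrightarrow> x \<otimes> f k \<in> B"
    and "inj_on (\<lambda>(x, k). x \<otimes> f k) (X \<times> K)"
  shows "card X * card K \<le> card B"
proof -
  have "card (X \<times> K) \<le> card B"
    using assms by (intro card_inj_on_le[of "\<lambda>(x, k). x \<otimes> f k"]) auto
  then show ?thesis by (simp add: card_cartesian_product)
qed

end

section \<open>Boxes in abelian groups\<close>

text \<open>Relations among the \<open>e i\<close> are allowed, so different exponent vectors may
  give the same element. Taking extensional vectors makes their number finite for finite
  \<open>I\<close>.\<close>

definition (in comm_group) box :: "'i set \<Rightarrow> ('i \<Rightarrow> 'a) \<Rightarrow> int \<Rightarrow> 'a set" where
  "box I e m = (\<lambda>v. \<Otimes>i\<in>I. e i [^] v i) ` (I \<rightarrow>\<^sub>E {-m..m})"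

context comm_group
begin

lemma finprod_in_box:
  assumes "e \<in> I \<rightarrow> carrier G" "\<And>i. i \<in> I \<Longrightarrow> \<bar>v i\<bar> \<le> m"
  shows "(\<Otimes>i\<in>I. e i [^] v i) \<in> box I e m"
  unfolding box_def
proof (rule image_eqI)
  show "(\<Otimes>i\<in>I. e i [^] v i) = (\<Otimes>i\<in>I. e i [^] restrict v I i)"
    using assms(1) by (intro finprod_cong') auto
  show "restrict v I \<in> I \<rightarrow>\<^sub>E {-m..m}"
    using assms(2) by (fastforce simp: abs_le_iff)
qed

lemma finite_box: "finite I \<Longrightarrow> finite (box I e m)"
  unfolding box_def by (intro finite_imageI finite_PiE) auto

text \<open>Dividing every exponent by \<open>m\<close> with remainder covers the large box by
  translates of the small one: the quotients lie in \<open>{- int c..int c}\<close> and index the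
  translates, while the remainders stay in the small box.\<close>

lemma card_box_le:
  assumes I: "finite I" "e \<in> I \<rightarrow> carrier G" and m: "m > 0"
  shows "card (box I e (int c * m)) \<le> (2 * c + 1) ^ card I * card (box I e m)"
proof -
  let ?U = "I \<rightarrow>\<^sub>E {- int c..int c}"
  let ?f = "\<lambda>(u, b). (\<Otimes>i\<in>I. e i [^] (m * u i)) \<otimes> b"
  have fin: "finite (?U \<times> box I e m)"
    using I by (intro finite_cartesian_product finite_PiE finite_box) auto
  have "box I e (int c * m) \<subseteq> ?f ` (?U \<times> box I e m)"
  proof
    fix a assume "a \<in> box I e (int c * m)"
    then obtain v where v: "\<And>i. i \<in> I \<Longrightarrow> \<bar>v i\<bar> \<le> int c * m"
      and a: "a = (\<Otimes>i\<in>I. e i [^] v i)"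
      by (fastforce simp: box_def PiE_iff abs_le_iff)
    define u where "u = restrict (\<lambda>i. v i div m) I"
    have "u \<in> ?U"
      unfolding u_def
    proof (rule restrict_PiE_iff[THEN iffD2], rule ballI)
      fix i assume "i \<in> I"
      \<comment> \<open>Written as a multiple of \<open>m\<close>, the lower bound divides to
        exactly \<open>- int c\<close>.\<close>
      with v[of i] have "v i \<le> int c * m" "(- int c) * m \<le> v i"
        by auto
      then show "v i div m \<in> {- int c..int c}"
        using m zdiv_mono1[of "v i" "int c * m" m] zdiv_mono1[of "(- int c) * m" "v i" m]
        by (simp del: mult_minus_left)
    qed
    moreover have "(\<Otimes>i\<in>I. e i [^] (v i mod m)) \<in> box I e m"
    proof (rule finprod_in_box[OF I(2)])
      show "\<bar>v i mod m\<bar> \<le> m" for i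
        using pos_mod_bound[OF m, of "v i"] pos_mod_sign[OF m, of "v i"] by linarith
    qed
    moreover have "a = ?f (u, \<Otimes>i\<in>I. e i [^] (v i mod m))"
    proof -
      have "a = (\<Otimes>i\<in>I. e i [^] (m * u i) \<otimes> e i [^] (v i mod m))"
        unfolding a
      proof (rule finprod_cong'[OF refl])
        show "(\<lambda>i. e i [^] (m * u i) \<otimes> e i [^] (v i mod m)) \<in> I \<rightarrow> carrier G"
          using I(2) by auto
        show "e i [^] v i = e i [^] (m * u i) \<otimes> e i [^] (v i mod m)" if "i \<in> I" for i
        proof -
          have "e i \<in> carrier G"
            using I(2) that by auto
          from int_pow_mult[OF this, of "m * u i" "v i mod m"] show ?thesis
            using that by (simp add: u_def)
        qed
      qed
      also have "\<dots> = ?f (u, \<Otimes>i\<in>I. e i [^] (v i mod m))"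
        using I(2) by (simp add: Pi_iff)
      finally show ?thesis .
    qed
    ultimately show "a \<in> ?f ` (?U \<times> box I e m)"
      by (intro image_eqI[of _ _ "(u, \<Otimes>i\<in>I. e i [^] (v i mod m))"] SigmaI)
  qed
  then have "card (box I e (int c * m)) \<le> card (?U \<times> box I e m)"
    by (rule surj_card_le[OF fin])
  also have "card ?U = (2 * c + 1) ^ card I"
    using I by (simp add: card_PiE nat_add_distrib nat_mult_distrib)
  then have "card (?U \<times> box I e m) = (2 * c + 1) ^ card I * card (box I e m)"
    by (simp add: card_cartesian_product)
  finally show ?thesis .
qed

end

section \<open>Abelian-by-cyclic groups\<close>

text \<open>The assumption \<open>t_pow_in_A\<close> says at once that \<open>t\<close> has infinite
  order and that its powers meet \<open>A\<close> only in the identity.\<close>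

locale abelian_by_infinite_cyclic = group G for G (structure) +
  fixes A S0 :: "'a set" and t :: 'a
  assumes normal: "A \<lhd> G"
    and comm: "comm_group (G\<lparr>carrier := A\<rparr>)"
    and t_closed [simp]: "t \<in> carrier G"
    and t_pow_in_A: "t [^] (k :: int) \<in> A \<Longrightarrow> k = 0"
    and finite_S0: "finite S0"
    and S0_subset: "S0 \<subseteq> A"
begin

abbreviation H :: "('a, 'b) monoid_scheme" where
  "H \<equiv> G\<lparr>carrier := A\<rparr>"

sublocale A: normal A G
  by (rule normal)

sublocale H: comm_group H
  rewrites "carrier H = A" and "mult H = mult G" and "one H = one G"
  by (simp_all add: comm)

abbreviation S :: "'a set" where
  "S \<equiv> S0 \<union> {t}"

lemma S_subset: "S \<subseteq> carrier G"
  using S0_subset A.subset by auto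

section \<open>Lamps: conjugates of generators by powers of \<open>t\<close>\<close>

definition gen :: "int \<times> 'a \<Rightarrow> 'a" where
  "gen x = t [^] fst x \<otimes> snd x \<otimes> t [^] (- fst x)"

text \<open>A pair \<open>(i, s)\<close> is a lamp of type \<open>s\<close> at position
  \<open>i\<close>, and \<open>v\<close> holds the settings. The product is taken in
  \<open>H\<close> because \<open>finprod\<close> relies on commutativity.\<close>

definition lamp :: "(int \<times> 'a) set \<Rightarrow> (int \<times> 'a \<Rightarrow> int) \<Rightarrow> 'a" where
  "lamp J v = finprod H (\<lambda>x. gen x [^] v x) J"

text \<open>The l1-norm of \<open>v\<close> on \<open>J\<close>: the number of letters from
  \<open>S0\<close> or their inverses spent on setting the lamps, without the cursor moves.\<close>

definition weight :: "(int \<times> 'a) set \<Rightarrow> (int \<times> 'a \<Rightarrow> int) \<Rightarrow> nat" where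
  "weight J v = (\<Sum>x\<in>J. nat \<bar>v x\<bar>)"

lemma in_A_closed [simp]: "a \<in> A \<Longrightarrow> a \<in> carrier G"
  using A.subset by auto

lemma t_pow_mult [simp]:
  "t [^] (i :: int) \<otimes> t [^] (j :: int) = t [^] (i + j)"
  "x \<in> carrier G \<Longrightarrow> t [^] (i :: int) \<otimes> (t [^] (j :: int) \<otimes> x) = t [^] (i + j) \<otimes> x"
  by (simp_all add: int_pow_mult flip: m_assoc)

lemma conj_in_A:
  assumes "a \<in> A"
  shows "t [^] (i :: int) \<otimes> a \<otimes> t [^] (- i) \<in> A"
  using assms A.inv_op_closed2[of "t [^] i" a] by (simp add: int_pow_neg)

lemma gen_in_A: "snd x \<in> S0 \<Longrightarrow> gen x \<in> A"
  unfolding gen_def using S0_subset by (auto intro: conj_in_A)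

lemma A_int_pow_closed [simp]: "a \<in> A \<Longrightarrow> a [^] (k :: int) \<in> A"
  using subgroup_int_pow_closed A.subgroup_axioms by blast

lemma H_int_pow: "a \<in> A \<Longrightarrow> a [^]\<^bsub>H\<^esub> (k :: int) = a [^] k"
  using int_pow_consistent[OF A.subgroup_axioms] by simp

lemma gen_pow_in_A: "snd x \<in> S0 \<Longrightarrow> gen x [^] (k :: int) \<in> A"
  by (simp add: gen_in_A)

lemma gen_pow_funcset: "J \<subseteq> UNIV \<times> S0 \<Longrightarrow> (\<lambda>x. gen x [^] (v x :: int)) \<in> J \<rightarrow> A"
  by (force intro: gen_pow_in_A)

lemma gen_pow:
  assumes "snd x \<in> S0"
  shows "gen x [^] (k :: int) = t [^] fst x \<otimes> snd x [^] k \<otimes> t [^] (- fst x)"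
proof -
  have c: "snd x \<in> carrier G"
    using assms S0_subset by auto
  have "(\<lambda>y. t [^] fst x \<otimes> y \<otimes> t [^] (- fst x)) \<in> hom G G"
    by (intro homI) (auto simp: m_assoc)
  from hom_int_pow[OF this c] show ?thesis
    using is_group by (simp add: gen_def)
qed

lemma lamp_in_A: "J \<subseteq> UNIV \<times> S0 \<Longrightarrow> lamp J v \<in> A"
  unfolding lamp_def by (rule H.finprod_closed) (rule gen_pow_funcset)

lemma lamp_empty [simp]: "lamp {} v = \<one>"
  by (simp add: lamp_def)

lemma lamp_insert:
  "finite J \<Longrightarrow> J \<subseteq> UNIV \<times> S0 \<Longrightarrow> x \<notin> J \<Longrightarrow> snd x \<in> S0 \<Longrightarrow>
    lamp (insert x J) v = gen x [^] v x \<otimes> lamp J v"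
  unfolding lamp_def by (rule H.finprod_insert) (simp_all add: gen_pow_funcset gen_pow_in_A)

lemma lamp_Un_disjoint:
  "finite J \<Longrightarrow> finite K \<Longrightarrow> J \<union> K \<subseteq> UNIV \<times> S0 \<Longrightarrow> J \<inter> K = {} \<Longrightarrow>
    lamp (J \<union> K) v = lamp J v \<otimes> lamp K v"
  unfolding lamp_def by (rule H.finprod_Un_disjoint) (simp_all add: gen_pow_funcset)

lemma lamp_cong:
  "J \<subseteq> UNIV \<times> S0 \<Longrightarrow> (\<And>x. x \<in> J \<Longrightarrow> v x = w x) \<Longrightarrow> lamp J v = lamp J w"
  unfolding lamp_def by (rule H.finprod_cong') (simp_all add: gen_pow_funcset)

lemma lamp_mono_neutral:
  "finite K \<Longrightarrow> J \<subseteq> K \<Longrightarrow> K \<subseteq> UNIV \<times> S0 \<Longrightarrow> (\<And>x. x \<in> K - J \<Longrightarrow> v x = 0) \<Longrightarrow>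
    lamp J v = lamp K v"
  unfolding lamp_def by (rule H.finprod_mono_neutral_cong_left) (simp_all add: gen_pow_funcset)

text \<open>Serves to read one more letter of a word: commutativity in \<open>A\<close> carries the
  extra power of one lamp past all others to the right end of the product.\<close>

lemma lamp_add_at:
  assumes J: "finite J" "J \<subseteq> UNIV \<times> S0" and x: "x \<in> J"
  shows "lamp J (v(x := v x + k)) = lamp J v \<otimes> gen x [^] k"
proof -
  let ?J = "J - {x}"
  have x': "snd x \<in> S0" and J': "finite ?J" "?J \<subseteq> UNIV \<times> S0" "insert x ?J = J"
    using J x by auto
  have split: "lamp J w = gen x [^] w x \<otimes> lamp ?J w" for w
    using lamp_insert[OF J'(1,2) _ x', of w] unfolding J'(3) by blast
  have J_eq: "lamp ?J (v(x := v x + k)) = lamp ?J v"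
    using J'(2) by (intro lamp_cong) auto
  have A: "lamp ?J v \<in> A" "gen x [^] k \<in> A" "gen x [^] v x \<in> A" "gen x \<in> A"
    using x' J'(2) by (auto intro: lamp_in_A gen_pow_in_A gen_in_A)
  have "lamp J (v(x := v x + k)) = gen x [^] v x \<otimes> (gen x [^] k \<otimes> lamp ?J v)"
    unfolding split J_eq using A by (simp add: int_pow_mult m_assoc)
  also have "\<dots> = gen x [^] v x \<otimes> (lamp ?J v \<otimes> gen x [^] k)"
    using H.m_comm[OF A(2,1)] by simp
  also have "\<dots> = lamp J v \<otimes> gen x [^] k"
    unfolding split using A by (simp add: m_assoc)
  finally show ?thesis .
qed

lemma lamp_uminus:
  assumes "finite J" "J \<subseteq> UNIV \<times> S0"
  shows "lamp J (\<lambda>x. - v x) = inv (lamp J v)"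
  using assms
proof (induction J)
  case (insert x J)
  then have "gen x [^] v x \<in> A" "lamp J v \<in> A"
    by (auto intro!: lamp_in_A gen_pow_in_A)
  then have "inv (gen x [^] v x \<otimes> lamp J v) = inv (gen x [^] v x) \<otimes> inv (lamp J v)"
    using inv_mult_group[of "lamp J v" "gen x [^] v x"] H.m_comm[of "lamp J v" "gen x [^] v x"]
    by simp
  with insert show ?case
    by (simp add: lamp_insert int_pow_neg gen_in_A mem_Times_iff)
qed simp

section \<open>Upper bounds for word lengths\<close>

lemma t_pow_in_word_ball: "nat \<bar>k\<bar> \<le> n \<Longrightarrow> t [^] k \<in> word_ball G S n"
  by (rule subsetD[OF word_ball_mono int_pow_in_word_ball[OF S_subset]]) simp_all

text \<open>Each lamp is set by its own return trip from position \<open>c\<close>. This is crude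
  but serves twice: if all lamps sit at \<open>c\<close>, the trips are free, and for a fixed finite
  \<open>J\<close> they cost a constant independent of \<open>v\<close>.\<close>

lemma conj_lamp_in_word_ball:
  assumes "finite J" "J \<subseteq> UNIV \<times> S0"
  shows "t [^] (- c) \<otimes> lamp J v \<otimes> t [^] c \<in>
    word_ball G S (\<Sum>x\<in>J. 2 * nat \<bar>fst x - c\<bar> + nat \<bar>v x\<bar>)"
  using assms
proof (induction J)
  case empty
  then show ?case by (simp add: one_in_word_ball)
next
  case (insert x J)
  let ?d = "fst x - c"
  have x: "snd x \<in> S0" "snd x \<in> carrier G" and J: "lamp J v \<in> carrier G"
    using insert S0_subset lamp_in_A[of J v] by auto
  have "t [^] ?d \<otimes> snd x [^] v x \<otimes> t [^] (- ?d) \<in>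
      word_ball G S (nat \<bar>?d\<bar> + nat \<bar>v x\<bar> + nat \<bar>?d\<bar>)"
    using x by (intro word_ball_mult[OF S_subset] t_pow_in_word_ball
        int_pow_in_word_ball[OF S_subset]) auto
  then have "t [^] ?d \<otimes> snd x [^] v x \<otimes> t [^] (- ?d) \<otimes> (t [^] (- c) \<otimes> lamp J v \<otimes> t [^] c) \<in>
      word_ball G S (nat \<bar>?d\<bar> + nat \<bar>v x\<bar> + nat \<bar>?d\<bar> +
        (\<Sum>x\<in>J. 2 * nat \<bar>fst x - c\<bar> + nat \<bar>v x\<bar>))"
    by (rule word_ball_mult[OF S_subset]) (use insert in auto)
  moreover have "t [^] (- c) \<otimes> lamp (insert x J) v \<otimes> t [^] c =
      t [^] ?d \<otimes> snd x [^] v x \<otimes> t [^] (- ?d) \<otimes> (t [^] (- c) \<otimes> lamp J v \<otimes> t [^] c)"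
    using insert x J by (simp add: lamp_insert gen_pow m_assoc)
  moreover have "nat \<bar>?d\<bar> + nat \<bar>v x\<bar> + nat \<bar>?d\<bar> + (\<Sum>x\<in>J. 2 * nat \<bar>fst x - c\<bar> + nat \<bar>v x\<bar>) =
      (\<Sum>x\<in>insert x J. 2 * nat \<bar>fst x - c\<bar> + nat \<bar>v x\<bar>)"
    using insert.hyps by (subst sum.insert) auto
  ultimately show ?case by metis
qed

text \<open>The cursor walks once from \<open>b\<close> to \<open>j\<close> and sets the lamps of
  each position on arrival. The powers of \<open>t\<close> between neighbouring positions
  telescope.\<close>

lemma sweep_in_word_ball:
  fixes b j :: int
  assumes "b \<le> j"
  shows "t [^] (- b) \<otimes> lamp ({b..j} \<times> S0) v \<otimes> t [^] j \<in>
    word_ball G S (weight ({b..j} \<times> S0) v + nat (j - b))"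
  using assms
proof (induction j rule: int_ge_induct)
  case base
  have "(\<Sum>x\<in>{b..b} \<times> S0. 2 * nat \<bar>fst x - b\<bar> + nat \<bar>v x\<bar>) = weight ({b..b} \<times> S0) v"
    unfolding weight_def by (intro sum.cong) auto
  with conj_lamp_in_word_ball[of "{b..b} \<times> S0" b v] finite_S0 show ?case
    by auto
next
  case (step j)
  let ?I = "{b..j} \<times> S0" and ?C = "{j + 1} \<times> S0"
  have split: "{b..j + 1} \<times> S0 = ?I \<union> ?C" "?I \<inter> ?C = {}"
    using step.hyps by auto
  \<comment> \<open>All lamps of the new column sit under the cursor, so the return trips
    vanish.\<close>
  have C: "(\<Sum>x\<in>?C. 2 * nat \<bar>fst x - (j + 1)\<bar> + nat \<bar>v x\<bar>) = weight ?C v"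
    unfolding weight_def by (intro sum.cong) auto
  have "t [^] (- b) \<otimes> lamp ?I v \<otimes> t [^] j \<otimes> t [^] (1 :: int) \<otimes>
      (t [^] (- (j + 1)) \<otimes> lamp ?C v \<otimes> t [^] (j + 1)) \<in>
      word_ball G S (weight ?I v + nat (j - b) + 1 + weight ?C v)"
  proof (rule word_ball_mult[OF S_subset word_ball_mult[OF S_subset step.IH]])
    show "t [^] (1 :: int) \<in> word_ball G S 1"
      by (rule t_pow_in_word_ball) simp
    show "t [^] (- (j + 1)) \<otimes> lamp ?C v \<otimes> t [^] (j + 1) \<in> word_ball G S (weight ?C v)"
      using finite_S0 by (intro conj_lamp_in_word_ball[of ?C "j + 1" v, unfolded C]) auto
  qed
  moreover have "t [^] (- b) \<otimes> lamp ?I v \<otimes> t [^] j \<otimes> t [^] (1 :: int) \<otimes>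
      (t [^] (- (j + 1)) \<otimes> lamp ?C v \<otimes> t [^] (j + 1)) =
      t [^] (- b) \<otimes> lamp ({b..j + 1} \<times> S0) v \<otimes> t [^] (j + 1)"
  proof -
    have "lamp ?I v \<in> carrier G" "lamp ?C v \<in> carrier G"
      by (auto intro!: in_A_closed lamp_in_A)
    moreover have "lamp ({b..j + 1} \<times> S0) v = lamp ?I v \<otimes> lamp ?C v"
      unfolding split(1) using finite_S0 split(2) by (intro lamp_Un_disjoint) auto
    ultimately show ?thesis
      by (simp add: m_assoc del: int_pow_1)
  qed
  moreover have "weight ({b..j + 1} \<times> S0) v = weight ?I v + weight ?C v"
    unfolding weight_def split(1) using finite_S0 split(2) by (intro sum.union_disjoint) auto
  moreover have "nat (j + 1 - b) = nat (j - b) + 1"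
    using step.hyps by simp
  ultimately show ?case
    by (simp add: add_ac)
qed

section \<open>Reading lamp configurations off words\<close>

lemma gen_mult_t_pow:
  assumes "s \<in> S0"
  shows "gen (k, s) [^] (e :: int) \<otimes> t [^] k = t [^] k \<otimes> s [^] e"
  using assms S0_subset by (simp add: gen_pow m_assoc subset_iff)

text \<open>Padding with zeros moves a configuration to a larger index set, either when the cursor
  range grows or when it is embedded into a fixed interval.\<close>

lemma lamp_extend:
  assumes "finite K" "K \<subseteq> UNIV \<times> S0" "J \<subseteq> K"
  shows "lamp K (\<lambda>x. if x \<in> J then v x else 0) = lamp J v"
proof -
  have "lamp J v = lamp J (\<lambda>x. if x \<in> J then v x else 0)"
    using assms by (intro lamp_cong) auto
  also have "\<dots> = lamp K (\<lambda>x. if x \<in> J then v x else 0)"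
    using assms by (intro lamp_mono_neutral) auto
  finally show ?thesis ..
qed

lemma weight_extend:
  assumes "finite K" "J \<subseteq> K"
  shows "weight K (\<lambda>x. if x \<in> J then v x else 0) = weight J v"
  unfolding weight_def using assms by (intro sum.mono_neutral_cong_right) auto

lemma weight_add_at:
  assumes "finite J" "x \<in> J"
  shows "weight J (v(x := v x + e)) \<le> weight J v + nat \<bar>e\<bar>"
proof -
  have "weight J w = nat \<bar>w x\<bar> + (\<Sum>y\<in>J - {x}. nat \<bar>w y\<bar>)" for w
    unfolding weight_def by (rule sum.remove[OF assms])
  then have "weight J (v(x := v x + e)) = nat \<bar>v x + e\<bar> + (\<Sum>y\<in>J - {x}. nat \<bar>v y\<bar>)"
    and "weight J v = nat \<bar>v x\<bar> + (\<Sum>y\<in>J - {x}. nat \<bar>v y\<bar>)"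
    by simp_all
  then show ?thesis by linarith
qed

lemma nat_abs_le_weight:
  assumes "finite J" "x \<in> J"
  shows "nat \<bar>v x\<bar> \<le> weight J v"
  unfolding weight_def by (rule member_le_sum[OF assms(2)]) (use assms in auto)

text \<open>
  The interval \<open>[-p, q]\<close> is the range of the exponent of \<open>t\<close> along a word. A walk from \<open>0\<close> to \<open>k\<close>
  that visits all of it has at least \<open>2 * p + 2 * q - \<bar>k\<bar>\<close> steps.
\<close>

lemma foldr_word_eq_lamp:
  assumes "set ws \<subseteq> S \<union> m_inv G ` S"
  shows "\<exists>(p :: nat) (q :: nat) k v. foldr (\<otimes>) ws \<one> = lamp ({- int p..int q} \<times> S0) v \<otimes> t [^] k \<and>
    - int p \<le> k \<and> k \<le> int q \<and>
    weight ({- int p..int q} \<times> S0) v + 2 * p + 2 * q \<le> length ws + nat \<bar>k\<bar>"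
  using assms
proof (induction ws rule: rev_induct)
  case Nil
  have "lamp ({0} \<times> S0) (\<lambda>_. 0) = \<one>"
    using lamp_extend[of "{0} \<times> S0" "{}"] finite_S0 by (simp add: Sigma_mono)
  moreover have "weight ({0} \<times> S0) (\<lambda>_. 0) = 0"
    by (simp add: weight_def)
  ultimately have "foldr (\<otimes>) [] \<one> = lamp ({- int 0..int 0} \<times> S0) (\<lambda>_. 0) \<otimes> t [^] (0 :: int) \<and>
      - int 0 \<le> 0 \<and> 0 \<le> int 0 \<and>
      weight ({- int 0..int 0} \<times> S0) (\<lambda>_. 0) + 2 * 0 + 2 * 0 \<le> length [] + nat \<bar>0\<bar>"
    by simp
  then show ?case by (elim conjE) (intro exI conjI)
next
  case (snoc y ws)
  let ?J = "\<lambda>(p :: nat) (q :: nat). {- int p..int q} \<times> S0"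
  have fin: "finite (?J p q)" "?J p q \<subseteq> UNIV \<times> S0" for p q
    using finite_S0 by auto
  from snoc obtain p q :: nat and k v where
    ws: "foldr (\<otimes>) ws \<one> = lamp (?J p q) v \<otimes> t [^] k" and
    k: "- int p \<le> k" "k \<le> int q" and
    le: "weight (?J p q) v + 2 * p + 2 * q \<le> length ws + nat \<bar>k\<bar>"
    by auto
  have L: "lamp (?J p q) v \<in> carrier G" for p q v
    by (rule in_A_closed[OF lamp_in_A[OF fin(2)]])
  \<comment> \<open>Generators and their inverses are treated together as powers with exponent 1 or
    -1.\<close>
  obtain s and e :: int where s: "s \<in> S" and e: "\<bar>e\<bar> = 1" and y: "y = s [^] e"
  proof -
    from snoc.prems consider "y \<in> S" | s where "s \<in> S" "y = inv s"
      by auto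
    then show ?thesis
    proof cases
      case 1
      then have "y \<in> carrier G" using S_subset by blast
      with 1 show ?thesis by (intro that[of y 1]) auto
    next
      case 2
      then have "s \<in> carrier G" using S_subset by blast
      with 2 show ?thesis by (intro that[of s "-1"]) (auto simp: int_pow_neg)
    qed
  qed
  have "S \<union> m_inv G ` S \<subseteq> carrier G" "set ws \<subseteq> S \<union> m_inv G ` S"
    using S_subset snoc.prems by auto
  then have closed: "set ws \<subseteq> carrier G" "s \<in> carrier G"
    using s by (blast intro: order_trans)+
  then have word: "foldr (\<otimes>) (ws @ [y]) \<one> = lamp (?J p q) v \<otimes> t [^] k \<otimes> s [^] e"
    using y ws by (simp add: foldr_mult_append del: foldr_append)
  show ?case
  proof (cases "s = t")
    case True
    \<comment> \<open>A letter from \<open>t\<close> moves the cursor to \<open>k + e\<close>. The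
      interval grows only if the cursor leaves it, and new lamps start at setting 0.\<close>
    define p' q' where "p' = nat (max (int p) (- (k + e)))" and "q' = nat (max (int q) (k + e))"
    define w where "w = (\<lambda>x. if x \<in> ?J p q then v x else 0)"
    have "?J p q \<subseteq> ?J p' q'"
      unfolding p'_def q'_def by auto
    then have "lamp (?J p' q') w = lamp (?J p q) v"
      and weight_w: "weight (?J p' q') w = weight (?J p q) v"
      unfolding w_def using fin by (auto intro!: lamp_extend weight_extend)
    then have "foldr (\<otimes>) (ws @ [y]) \<one> = lamp (?J p' q') w \<otimes> t [^] (k + e)"
      unfolding word True using L by (simp add: m_assoc)
    \<comment> \<open>Inside the old interval only the distance of the cursor from 0 changes, by
      one. Leaving the interval adds 2 on the left, paid by the new letter and by the growth of that
      distance.\<close>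
    moreover have "2 * p' + 2 * q' + nat \<bar>k\<bar> \<le> 2 * p + 2 * q + nat \<bar>k + e\<bar> + 1"
      unfolding p'_def q'_def using k e by (auto simp: max_def)
    with le have "weight (?J p' q') w + 2 * p' + 2 * q' \<le> length (ws @ [y]) + nat \<bar>k + e\<bar>"
      unfolding weight_w by simp
    moreover have "- int p' \<le> k + e" "k + e \<le> int q'"
      unfolding p'_def q'_def by auto
    ultimately show ?thesis by (intro exI conjI)
  next
    case False
    with s have s: "s \<in> S0" by auto
    \<comment> \<open>A letter from \<open>S0\<close> acts on the lamp at the cursor position
      \<open>k\<close>, which already lies in the interval.\<close>
    let ?x = "(k, s)" and ?w = "v((k, s) := v (k, s) + e)"
    have x: "?x \<in> ?J p q"
      using s k by auto
    have "lamp (?J p q) ?w \<otimes> t [^] k = lamp (?J p q) v \<otimes> (gen ?x [^] e \<otimes> t [^] k)"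
      unfolding lamp_add_at[OF fin x] using L s gen_pow_in_A[of ?x e] by (simp add: m_assoc)
    also have "\<dots> = lamp (?J p q) v \<otimes> t [^] k \<otimes> s [^] e"
      using L closed s by (simp add: gen_mult_t_pow m_assoc)
    finally have "foldr (\<otimes>) (ws @ [y]) \<one> = lamp (?J p q) ?w \<otimes> t [^] k"
      unfolding word ..
    moreover have "weight (?J p q) ?w \<le> weight (?J p q) v + 1"
      using weight_add_at[OF fin(1) x, of v e] e by simp
    with le have "weight (?J p q) ?w + 2 * p + 2 * q \<le> length (ws @ [y]) + nat \<bar>k\<bar>"
      by simp
    ultimately show ?thesis
      using k by (intro exI conjI)
  qed
qed

text \<open>For an element of \<open>A\<close> the cursor must return to 0, since
  \<open>t [^] k\<close> is then a quotient of two elements of \<open>A\<close>. Hence no part of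
  the travel cost \<open>2 * p + 2 * q\<close> is saved.\<close>

lemma word_ball_Int_A_eq_lamp:
  assumes "a \<in> A \<inter> word_ball G S n"
  obtains p q :: nat and v where "a = lamp ({- int p..int q} \<times> S0) v"
    "weight ({- int p..int q} \<times> S0) v + 2 * p + 2 * q \<le> n"
proof -
  from assms obtain ws where ws: "set ws \<subseteq> S \<union> m_inv G ` S" "foldr (\<otimes>) ws \<one> = a" "length ws \<le> n"
    by (auto simp: mem_word_ball_iff words_for_def)
  from foldr_word_eq_lamp[OF ws(1)] obtain p q :: nat and k v where
    a: "a = lamp ({- int p..int q} \<times> S0) v \<otimes> t [^] k" and
    le: "weight ({- int p..int q} \<times> S0) v + 2 * p + 2 * q \<le> length ws + nat \<bar>k\<bar>"
    unfolding ws(2) by (elim exE conjE)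
  let ?L = "lamp ({- int p..int q} \<times> S0) v"
  have L: "?L \<in> A"
    by (rule lamp_in_A) auto
  then have "t [^] k = inv ?L \<otimes> a"
    unfolding a by (simp flip: m_assoc)
  then have "k = 0"
    using L assms t_pow_in_A by simp
  then show ?thesis
    using that[of p q v] a le ws(3) L by simp
qed

section \<open>Tours that end away from the origin\<close>

lemma lamp_mult_t_pow_in_word_ball:
  assumes "0 \<le> k" "k \<le> int q"
  shows "lamp ({- int p..int q} \<times> S0) v \<otimes> t [^] k \<in>
    word_ball G S (weight ({- int p..int q} \<times> S0) v + 2 * p + 2 * q)"
proof -
  let ?J = "{- int p..int q} \<times> S0"
  have "lamp ?J v \<in> carrier G"
    by (rule in_A_closed[OF lamp_in_A]) auto
  \<comment> \<open>The tour goes left to \<open>- int p\<close>, sweeps right to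
    \<open>int q\<close> and returns to \<open>k\<close>. As \<open>k\<close> is nonnegative, the
    last leg takes at most \<open>q\<close> steps.\<close>
  then have "lamp ?J v \<otimes> t [^] k =
      t [^] (- int p) \<otimes> (t [^] (- (- int p)) \<otimes> lamp ?J v \<otimes> t [^] int q) \<otimes> t [^] (k - int q)"
    by (simp add: m_assoc)
  also have "\<dots> \<in> word_ball G S (p + (weight ?J v + nat (int q - (- int p))) + q)"
    using assms by (intro word_ball_mult[OF S_subset] sweep_in_word_ball t_pow_in_word_ball) auto
  also have "p + (weight ?J v + nat (int q - (- int p))) + q = weight ?J v + 2 * p + 2 * q"
    by (simp add: nat_add_distrib)
  finally show ?thesis .
qed

text \<open>The opposite sweep comes from inverting the sweep that collects the inverse lamps.\<close>

lemma lamp_mult_t_pow_neg_in_word_ball: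
  assumes "- int p \<le> k" "k \<le> 0"
  shows "lamp ({- int p..int q} \<times> S0) v \<otimes> t [^] k \<in>
    word_ball G S (weight ({- int p..int q} \<times> S0) v + 2 * p + 2 * q)"
proof -
  let ?J = "{- int p..int q} \<times> S0" and ?w = "\<lambda>x. - v x"
  have L: "lamp ?J v \<in> carrier G"
    by (rule in_A_closed[OF lamp_in_A]) auto
  have weight: "weight ?J ?w = weight ?J v"
    by (simp add: weight_def)
  have "lamp ?J ?w = inv (lamp ?J v)"
    using finite_S0 by (intro lamp_uminus) auto
  then have "inv (t [^] (- (- int p)) \<otimes> lamp ?J ?w \<otimes> t [^] int q) =
      t [^] (- int q) \<otimes> (lamp ?J v \<otimes> t [^] (- int p))"
    using L by (simp add: inv_mult_group m_assoc int_pow_neg)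
  \<comment> \<open>The mirror tour goes right to \<open>int q\<close>, sweeps left to
    \<open>- int p\<close> and returns to \<open>k\<close>. As \<open>k\<close> is nonpositive, the
    last leg takes at most \<open>p\<close> steps.\<close>
  then have "lamp ?J v \<otimes> t [^] k =
      t [^] int q \<otimes> inv (t [^] (- (- int p)) \<otimes> lamp ?J ?w \<otimes> t [^] int q) \<otimes> t [^] (k + int p)"
    using L by (simp add: m_assoc)
  also have "\<dots> \<in> word_ball G S (q + (weight ?J ?w + nat (int q - (- int p))) + p)"
    using assms
    by (intro word_ball_mult[OF S_subset] word_ball_inv[OF S_subset] sweep_in_word_ball
        t_pow_in_word_ball) auto
  also have "q + (weight ?J ?w + nat (int q - (- int p))) + p = weight ?J v + 2 * p + 2 * q"
    by (simp add: nat_add_distrib weight)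
  finally show ?thesis .
qed

section \<open>Counting translates by powers of \<open>t\<close>\<close>

lemma inj_on_mult_t_pow: "inj_on (\<lambda>(a, k :: int). a \<otimes> t [^] k) (A \<times> K)"
proof (rule inj_onI, clarify)
  fix a b and k l :: int
  assume ab: "a \<in> A" "b \<in> A" and eq: "a \<otimes> t [^] k = b \<otimes> t [^] l"
  have "t [^] (k - l) = inv a \<otimes> (a \<otimes> t [^] k) \<otimes> t [^] (- l)"
    using ab by (simp add: m_assoc flip: m_assoc[of "inv a" a])
  also have "\<dots> = inv a \<otimes> b"
    unfolding eq using ab by (simp add: m_assoc)
  finally have "t [^] (k - l) = inv a \<otimes> b" .
  with ab have "t [^] (k - l) \<in> A"
    by simp
  then have "k = l"
    using t_pow_in_A[of "k - l"] by simp
  with eq ab show "a = b \<and> k = l"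
    by simp
qed

text \<open>An element of \<open>A\<close> times a power of \<open>t\<close> determines both
  factors, so the translates of \<open>X\<close> are disjoint subsets of the ball.\<close>

lemma card_translates_le:
  fixes K :: "int set"
  assumes "X \<subseteq> A" "finite K" "\<And>a k. a \<in> X \<Longrightarrow> k \<in> K \<Longrightarrow> a \<otimes> t [^] k \<in> word_ball G S n"
  shows "card X * card K \<le> card (word_ball G S n)"
proof (rule card_mult_le_if_translates)
  show "inj_on (\<lambda>(a, k). a \<otimes> t [^] k) (X \<times> K)"
    using assms(1) by (intro inj_on_subset[OF inj_on_mult_t_pow[of K]]) auto
qed (use assms A.subset finite_S0 in \<open>auto intro!: finite_word_ball\<close>)

section \<open>Boxes of lamp configurations\<close>

lemma lamp_eq_finprod_H:
  assumes "J \<subseteq> UNIV \<times> S0"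
  shows "finprod H (\<lambda>x. gen x [^]\<^bsub>H\<^esub> v x) J = lamp J v"
  unfolding lamp_def using assms
  by (intro H.finprod_cong' gen_pow_funcset refl) (auto intro!: H_int_pow gen_in_A)

text \<open>Replaces extensional exponent vectors and powers in \<open>H\<close> by arbitrary
  \<open>v\<close> and powers in \<open>G\<close>, the form in which word lengths were
  bounded.\<close>

lemma box_gen_eq:
  assumes "J \<subseteq> UNIV \<times> S0"
  shows "H.box J gen m = {lamp J v | v. \<forall>x\<in>J. \<bar>v x\<bar> \<le> m}"
proof (intro equalityI subsetI)
  fix a assume "a \<in> H.box J gen m"
  then obtain v where "v \<in> J \<rightarrow>\<^sub>E {-m..m}" "a = lamp J v"
    unfolding H.box_def by (auto simp: lamp_eq_finprod_H[OF assms])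
  moreover from this(1) have "\<forall>x\<in>J. \<bar>v x\<bar> \<le> m"
    by (fastforce simp: abs_le_iff dest: PiE_mem)
  ultimately show "a \<in> {lamp J v | v. \<forall>x\<in>J. \<bar>v x\<bar> \<le> m}"
    by blast
next
  fix a assume "a \<in> {lamp J v | v. \<forall>x\<in>J. \<bar>v x\<bar> \<le> m}"
  then obtain v where v: "\<forall>x\<in>J. \<bar>v x\<bar> \<le> m" and a: "a = lamp J v"
    by blast
  have "gen \<in> J \<rightarrow> A"
    using assms by (force intro: gen_in_A)
  from H.finprod_in_box[OF this, of v m] v show "a \<in> H.box J gen m"
    by (simp add: a lamp_eq_finprod_H[OF assms])
qed

text \<open>
  Boxes of a fixed dimension are doubling, so the translates by powers of \<open>t\<close> of a smaller box
  already fill more of the ball than the large box does.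
\<close>

lemma eventually_card_box_le:
  fixes M :: nat
  defines "J \<equiv> {- int M..int M} \<times> S0"
  shows "\<forall>\<^sub>F n in sequentially. (M + 1) * card (H.box J gen (int n)) \<le> card (word_ball G S n)"
proof -
  \<comment> \<open>With \<open>c > 2 * d\<close>, setting \<open>d\<close> lamps to values of size
    about \<open>n / c\<close> uses at most half of \<open>n\<close>. The other half absorbs the
    constant costs once \<open>n\<close> is large.\<close>
  define d c where "d = card J" and "c = 2 * d + 1"
  \<comment> \<open>The first factor bounds how many small boxes cover the large one, so
    \<open>K\<close> translates of the small box outweigh \<open>M + 1\<close> copies of the large
    box.\<close>
  define K where "K = (2 * c + 1) ^ d * (M + 1)"
  have J: "finite J" "J \<subseteq> UNIV \<times> S0" "gen \<in> J \<rightarrow> A"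
    unfolding J_def using finite_S0 by (auto intro: gen_in_A)
  have "(M + 1) * card (H.box J gen (int n)) \<le> card (word_ball G S n)"
    if n: "n \<ge> 2 * (d * (2 * M + 1) + K)" for n
  proof -
    \<comment> \<open>Adding 1 makes \<open>m\<close> positive and ensures that \<open>c * m\<close>
      is at least \<open>n\<close>.\<close>
    define m where "m = n div c + 1"
    have "2 * d * (n div c) \<le> c * (n div c)"
      by (simp add: c_def)
    also have "\<dots> \<le> n"
      by simp
    finally have bound: "d * (2 * M + m) + K \<le> n"
      using n by (simp add: m_def algebra_simps)
    have "n \<le> c * m"
    proof -
      have "n = c * (n div c) + n mod c"
        by (rule mult_div_mod_eq[symmetric])
      moreover have "n mod c < c"
        by (simp add: c_def)
      ultimately show ?thesis
        unfolding m_def add_mult_distrib2 by linarith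
    qed
    then have nm: "int n \<le> int c * int m"
      by (simp flip: of_nat_mult)
    have "H.box J gen (int n) \<subseteq> H.box J gen (int c * int m)"
      unfolding box_gen_eq[OF J(2)] using order_trans[OF _ nm] by blast
    then have "card (H.box J gen (int n)) \<le> card (H.box J gen (int c * int m))"
      by (intro card_mono H.finite_box J)
    also have "\<dots> \<le> (2 * c + 1) ^ d * card (H.box J gen (int m))"
      unfolding d_def by (rule H.card_box_le) (use J in \<open>auto simp: m_def\<close>)
    finally have "(M + 1) * card (H.box J gen (int n)) \<le>
        (M + 1) * ((2 * c + 1) ^ d * card (H.box J gen (int m)))"
      by (rule mult_le_mono2)
    also have "\<dots> \<le> card (H.box J gen (int m)) * card {0..int K}"
    proof -
      have "card {0..int K} = K + 1"
        by simp
      then show ?thesis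
        unfolding K_def by (simp only:) (simp add: algebra_simps)
    qed
    also have "\<dots> \<le> card (word_ball G S n)"
    proof (rule card_translates_le)
      show "H.box J gen (int m) \<subseteq> A"
        unfolding box_gen_eq[OF J(2)] using lamp_in_A[OF J(2)] by blast
      fix a k assume "a \<in> H.box J gen (int m)" and k: "k \<in> {0..int K}"
      then obtain v where a: "a = lamp J v" and v: "\<And>x. x \<in> J \<Longrightarrow> \<bar>v x\<bar> \<le> int m"
        unfolding box_gen_eq[OF J(2)] by blast
      have "a \<in> carrier G"
        unfolding a by (rule in_A_closed[OF lamp_in_A[OF J(2)]])
      then have "a \<in> word_ball G S (\<Sum>x\<in>J. 2 * nat \<bar>fst x - 0\<bar> + nat \<bar>v x\<bar>)"
        using conj_lamp_in_word_ball[OF J(1,2), of 0 v] by (simp add: a)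
      moreover have "t [^] k \<in> word_ball G S K"
        using k by (intro t_pow_in_word_ball) auto
      ultimately have ball: "a \<otimes> t [^] k \<in> word_ball G S ((\<Sum>x\<in>J. 2 * nat \<bar>fst x - 0\<bar> + nat \<bar>v x\<bar>) + K)"
        by (rule word_ball_mult[OF S_subset])
      have "(\<Sum>x\<in>J. 2 * nat \<bar>fst x - 0\<bar> + nat \<bar>v x\<bar>) \<le> d * (2 * M + m)"
      proof -
        have "2 * nat \<bar>fst x - 0\<bar> + nat \<bar>v x\<bar> \<le> 2 * M + m" if "x \<in> J" for x
          using v[OF that] that by (auto simp: J_def)
        from sum_bounded_above[OF this] show ?thesis
          by (simp add: d_def)
      qed
      with bound have "(\<Sum>x\<in>J. 2 * nat \<bar>fst x - 0\<bar> + nat \<bar>v x\<bar>) + K \<le> n"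
        by linarith
      then show "a \<otimes> t [^] k \<in> word_ball G S n"
        by (rule subsetD[OF word_ball_mono ball])
    qed simp
    finally show ?thesis .
  qed
  then show ?thesis
    by (rule eventually_sequentiallyI)
qed

section \<open>Vanishing density\<close>

lemma eventually_card_Int_word_ball_le:
  fixes M :: nat
  shows "\<forall>\<^sub>F n in sequentially. (M + 1) * card (A \<inter> word_ball G S n) \<le> 3 * card (word_ball G S n)"
  using eventually_card_box_le[of M]
proof eventually_elim
  case (elim n)
  define J where "J = {- int M..int M} \<times> S0"
  \<comment> \<open>If \<open>K\<close> has \<open>M + 1\<close> elements, then disjointness of
    translates limits \<open>U K\<close> to a fraction \<open>1 / (M + 1)\<close> of the
    ball.\<close>
  define U where "U K = {a \<in> A. \<forall>k \<in> K. a \<otimes> t [^] k \<in> word_ball G S n}" for K :: "int set"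
  have J: "finite J" "J \<subseteq> UNIV \<times> S0"
    unfolding J_def using finite_S0 by auto
  have U: "(M + 1) * card (U K) \<le> card (word_ball G S n)" if "card K = M + 1" "finite K" for K
    using card_translates_le[of "U K" K n] that by (auto simp: U_def mult.commute)
  \<comment> \<open>The translate with \<open>k = 0\<close> places \<open>U K\<close> inside the
    finite ball.\<close>
  have finite_U: "finite (U K)" if "0 \<in> K" for K
    by (rule finite_subset[OF _ finite_word_ball[of S G n]])
      (use that finite_S0 in \<open>force simp: U_def\<close>)+
  have "A \<inter> word_ball G S n \<subseteq> U {0..int M} \<union> U {- int M..0} \<union> H.box J gen (int n)"
  proof
    fix a assume a: "a \<in> A \<inter> word_ball G S n"
    then obtain p q :: nat and v where a_eq: "a = lamp ({- int p..int q} \<times> S0) v"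
      and le: "weight ({- int p..int q} \<times> S0) v + 2 * p + 2 * q \<le> n"
      by (rule word_ball_Int_A_eq_lamp)
    \<comment> \<open>If the cursor range reaches \<open>M\<close> on one side, tours can end at
      \<open>M + 1\<close> positions on that side. Otherwise all lamps lie in
      \<open>J\<close>.\<close>
    consider "M \<le> q" | "M \<le> p" | "p \<le> M" "q \<le> M"
      by linarith
    then show "a \<in> U {0..int M} \<union> U {- int M..0} \<union> H.box J gen (int n)"
    proof cases
      case 1
      have "a \<otimes> t [^] k \<in> word_ball G S n" if "k \<in> {0..int M}" for k
        unfolding a_eq
        by (rule subsetD[OF word_ball_mono[OF le] lamp_mult_t_pow_in_word_ball])
          (use 1 that in auto)
      with a show ?thesis by (auto simp: U_def)
    next
      case 2
      have "a \<otimes> t [^] k \<in> word_ball G S n" if "k \<in> {- int M..0}" for k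
        unfolding a_eq
        by (rule subsetD[OF word_ball_mono[OF le] lamp_mult_t_pow_neg_in_word_ball])
          (use 2 that in auto)
      with a show ?thesis by (auto simp: U_def)
    next
      case 3
      let ?I = "{- int p..int q} \<times> S0"
      have "a = lamp J (\<lambda>x. if x \<in> ?I then v x else 0)"
        unfolding a_eq by (rule lamp_extend[symmetric, OF J]) (use 3 in \<open>auto simp: J_def\<close>)
      \<comment> \<open>Each single setting is bounded by the weight, hence by
        \<open>n\<close>.\<close>
      moreover have "\<bar>if x \<in> ?I then v x else 0\<bar> \<le> int n" for x
        using nat_abs_le_weight[of ?I x v] finite_S0 le by auto
      ultimately show ?thesis
        unfolding box_gen_eq[OF J(2)] by blast
    qed
  qed
  then have "card (A \<inter> word_ball G S n) \<le>
      card (U {0..int M} \<union> U {- int M..0} \<union> H.box J gen (int n))"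
    using finite_U H.finite_box[OF J(1)] by (intro card_mono) auto
  also have "\<dots> \<le> card (U {0..int M}) + card (U {- int M..0}) + card (H.box J gen (int n))"
    by (meson add_le_mono1 card_Un_le order_trans)
  finally have "(M + 1) * card (A \<inter> word_ball G S n) \<le>
      (M + 1) * card (U {0..int M}) + (M + 1) * card (U {- int M..0}) +
      (M + 1) * card (H.box J gen (int n))"
    unfolding add_mult_distrib2[symmetric] by (rule mult_le_mono2)
  also have "\<dots> \<le> card (word_ball G S n) + card (word_ball G S n) + card (word_ball G S n)"
    using elim by (intro add_mono U) (auto simp: J_def)
  finally show ?case by simp
qed

text \<open>For every \<open>M\<close> the ratio is eventually at most \<open>3 / (M + 1)\<close>,
  so it converges to 0, and the upper limit equals this limit.\<close>

lemma group_density_A: "group_density G S A = 0"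
proof -
  let ?r = "\<lambda>n. real (card (A \<inter> word_ball G S n)) / real (card (word_ball G S n))"
  have "?r \<longlonglongrightarrow> 0"
  proof (rule tendstoI)
    fix \<epsilon> :: real assume "\<epsilon> > 0"
    then obtain M :: nat where M: "3 / \<epsilon> < real M"
      using reals_Archimedean2 by blast
    show "\<forall>\<^sub>F n in sequentially. dist (?r n) 0 < \<epsilon>"
      using eventually_card_Int_word_ball_le[of M]
    proof eventually_elim
      case (elim n)
      have "card (word_ball G S n) > 0"
        using one_in_word_ball[of S n] finite_word_ball[of S G n] finite_S0
        by (auto simp: card_gt_0_iff)
      moreover have "real (M + 1) * real (card (A \<inter> word_ball G S n)) \<le> 3 * real (card (word_ball G S n))"
        using elim by (metis of_nat_le_iff of_nat_mult of_nat_numeral)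
      ultimately have "?r n \<le> 3 / (real M + 1)"
        by (simp add: field_simps)
      also have "\<dots> < \<epsilon>"
        using M \<open>\<epsilon> > 0\<close> by (simp add: field_simps)
      finally show ?case by simp
    qed
  qed
  then have "(\<lambda>n. ereal (?r n)) \<longlonglongrightarrow> 0"
    by (simp add: zero_ereal_def)
  then show ?thesis
    unfolding group_density_def by (intro lim_imp_Limsup) auto
qed

end

theorem corollary1p3:
  fixes G :: "('a, 'b) monoid_scheme" and A S S0 :: "'a set" and t :: 'a
  assumes "group G"
    and "t \<in> carrier G"
    and "internal_semidirect_product G A (generate G {t})"
    and "comm_group (G\<lparr>carrier := A\<rparr>)"
    and "G\<lparr>carrier := generate G {t}\<rparr> \<cong> integer_group"
    and "finite_generating_set G S"
    and "S = S0 \<union> {t}"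
    and "S0 \<subseteq> A"
  shows "group_density G S A = 0"
proof -
  interpret group G by fact
  have "infinite (generate G {t})"
  proof -
    obtain h where "bij_betw h (generate G {t}) (UNIV :: int set)"
      using assms(5) by (auto simp: is_iso_def iso_def)
    then show ?thesis
      using bij_betw_finite infinite_UNIV_int by blast
  qed
  \<comment> \<open>Infinite order is encoded as \<open>ord t = 0\<close>, in line with
    \<open>card\<close> being 0 on infinite sets.\<close>
  then have ord: "ord t = 0"
    using generate_pow_card[OF assms(2)] by simp
  have "k = 0" if "t [^]\<^bsub>G\<^esub> k \<in> A" for k :: int
  proof -
    have "t [^]\<^bsub>G\<^esub> k \<in> generate G {t}"
      using generate_pow[OF assms(2)] by blast
    with that assms(3) have "t [^]\<^bsub>G\<^esub> k = \<one>\<^bsub>G\<^esub>"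
      unfolding internal_semidirect_product_def by blast
    then show ?thesis
      using int_pow_eq_id[OF assms(2)] ord by simp
  qed
  then interpret abelian_by_infinite_cyclic G A S0 t
    using assms is_group
    by (intro abelian_by_infinite_cyclic.intro abelian_by_infinite_cyclic_axioms.intro)
      (auto simp: internal_semidirect_product_def finite_generating_set_def)
  show ?thesis
    unfolding assms(7) by (rule group_density_A)
qed

end
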